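(* If the infinite server problem on the real line is $\rho$-competitive, then for every $h\in\mathbb{N}$ and every $\epsilon>0$, the $(h,k)$-server problem on the real line is $(3+\epsilon)\rho$-competitive whenever $k\ge 2\lceil(1+1/\epsilon)\rho h\rceil$.
   Context: Infinite server problem on $(M,s)$: $M$ is a metric space and $s\in M$ the source; an unbounded number of servers initially reside at $s$. A finite sequence of requests (points of $M$) is revealed one by one; each must be served immediately, without knowledge of future requests, by moving some server to the requested point. The cost is the total distance traveled. On the real line the source is a fixed point (e.g. $0$). The $(h,k)$-server problem ($k\ge h$): the online algorithm has $k$ servers and is compared against an optimal offline algorithm with $h$ servers. All online algorithms are deterministic. $ALG$ is $\rho$-competitive if there is a constant $c$ independent of $\sigma$ with $ALG(\sigma)\le\rho\, OPT(\sigma)+c$ for every request sequence $\sigma$. *)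

theory Defs
  imports Complex_Main
begin

text \<open>Servers are indexed by natural numbers; a configuration assigns each server a
position on the real line.  The set U of usable server indices is {..<k} for the
k-server setting and UNIV for the infinite server problem.  Unusable servers are
pinned at the source 0 and never move.  All servers start at the source 0.\<close>

definition cfg_cost :: "(nat \<Rightarrow> real) \<Rightarrow> (nat \<Rightarrow> real) \<Rightarrow> real" where
  "cfg_cost c d = (\<Sum>i\<in>{i. c i \<noteq> d i}. \<bar>d i - c i\<bar>)"

definition valid_step :: "nat set \<Rightarrow> (nat \<Rightarrow> real) \<Rightarrow> (nat \<Rightarrow> real) \<Rightarrow> real \<Rightarrow> bool" where
  "valid_step U c d r \<longleftrightarrow>
     (\<forall>i. i \<notin> U \<longrightarrow> d i = 0) \<and> finite {i. c i \<noteq> d i} \<and> (\<exists>i\<in>U. d i = r)"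

text \<open>A deterministic online algorithm: the configuration after serving a request
prefix depends only on that prefix.\<close>
definition online_alg :: "nat set \<Rightarrow> (real list \<Rightarrow> nat \<Rightarrow> real) \<Rightarrow> bool" where
  "online_alg U A \<longleftrightarrow> A [] = (\<lambda>_. 0) \<and> (\<forall>xs r. valid_step U (A xs) (A (xs @ [r])) r)"

definition alg_cost :: "(real list \<Rightarrow> nat \<Rightarrow> real) \<Rightarrow> real list \<Rightarrow> real" where
  "alg_cost A \<sigma> = (\<Sum>j<length \<sigma>. cfg_cost (A (take j \<sigma>)) (A (take (Suc j) \<sigma>)))"

definition schedule :: "nat set \<Rightarrow> real list \<Rightarrow> (nat \<Rightarrow> nat \<Rightarrow> real) \<Rightarrow> bool" where
  "schedule U \<sigma> S \<longleftrightarrow> S 0 = (\<lambda>_. 0) \<and>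
     (\<forall>j<length \<sigma>. valid_step U (S j) (S (Suc j)) (\<sigma> ! j))"

definition sched_cost :: "real list \<Rightarrow> (nat \<Rightarrow> nat \<Rightarrow> real) \<Rightarrow> real" where
  "sched_cost \<sigma> S = (\<Sum>j<length \<sigma>. cfg_cost (S j) (S (Suc j)))"

definition opt_cost :: "nat set \<Rightarrow> real list \<Rightarrow> real" where
  "opt_cost U \<sigma> = Inf (sched_cost \<sigma> ` {S. schedule U \<sigma> S})"

definition competitive :: "nat set \<Rightarrow> nat set \<Rightarrow> real \<Rightarrow> bool" where
  "competitive U V \<rho> \<longleftrightarrow> (\<exists>A. online_alg U A \<and>
     (\<exists>c. \<forall>\<sigma>. alg_cost A \<sigma> \<le> \<rho> * opt_cost V \<sigma> + c))"

end

theory Submission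
  imports Defs
begin

text \<open>Positions are split into positive and negative parts, so it suffices to play on a half-line with
  \<open>B = \<lceil>(1 + 1/\<epsilon>)\<rho>h\<rceil>\<close> servers.  There we simulate the infinite server algorithm on the requests
  translated by \<open>L\<close>, so that the source lies at distance \<open>L\<close>.  The simulation pays at most
  \<open>\<rho>(hL + OPT) + c\<close>, of which \<open>mL\<close> goes into bringing its \<open>m\<close> active servers onto the half-line.
  When \<open>m\<close> exceeds \<open>B\<close>, we return all servers to \<open>0\<close> and switch to the simulation, from the first
  request on, with \<open>L' = \<epsilon> OPT/h\<close>.  Writing \<open>T = hL/\<epsilon>\<close>, the abandoned simulation has moved its
  servers on the half-line by at most \<open>\<rho>(T' - T)\<close>.  Hence all abandoned simulations together, with
  the returns, cost at most \<open>2\<rho>OPT\<close>, while the current one costs at most \<open>\<rho>(\<epsilon>OPT + OPT)\<close>,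
  up to additive constants.\<close>

section \<open>Costs of configurations, algorithms and schedules\<close>

lemma cfg_cost_eq_sum:
  assumes "finite X" "{i. c i \<noteq> d i} \<subseteq> X"
  shows "cfg_cost c d = (\<Sum>i\<in>X. \<bar>d i - c i\<bar>)"
  unfolding cfg_cost_def using assms by (intro sum.mono_neutral_left) auto

lemma cfg_cost_eq_sum_lessThan:
  assumes "\<And>i. i \<ge> n \<Longrightarrow> c i = d i"
  shows "cfg_cost c d = (\<Sum>i<n. \<bar>d i - c i\<bar>)"
  using assms by (intro cfg_cost_eq_sum) (auto simp flip: not_le)

lemma cfg_cost_nonneg: "cfg_cost c d \<ge> 0"
  unfolding cfg_cost_def by (rule sum_nonneg) auto

lemma cfg_cost_commute: "cfg_cost c d = cfg_cost d c"
  unfolding cfg_cost_def by (rule sum.cong) auto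

lemma cfg_cost_triangle:
  assumes "finite {i. a i \<noteq> b i}" "finite {i. b i \<noteq> c i}"
  shows "cfg_cost a c \<le> cfg_cost a b + cfg_cost b c"
proof -
  let ?X = "{i. a i \<noteq> b i} \<union> {i. b i \<noteq> c i}"
  have X: "finite ?X" using assms by simp
  have "cfg_cost a c = (\<Sum>i\<in>?X. \<bar>c i - a i\<bar>)"
    using X by (rule cfg_cost_eq_sum) auto
  also have "\<dots> \<le> (\<Sum>i\<in>?X. \<bar>b i - a i\<bar> + \<bar>c i - b i\<bar>)"
    by (rule sum_mono) linarith
  also have "\<dots> = cfg_cost a b + cfg_cost b c"
    unfolding sum.distrib using X
    by (subst (1 2) cfg_cost_eq_sum[of ?X]) auto
  finally show ?thesis .
qed

lemma alg_cost_Nil [simp]: "alg_cost A [] = 0"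
  by (simp add: alg_cost_def)

lemma alg_cost_snoc [simp]:
  "alg_cost A (xs @ [r]) = alg_cost A xs + cfg_cost (A xs) (A (xs @ [r]))"
  unfolding alg_cost_def by (simp add: lessThan_Suc)

lemma alg_cost_nonneg: "alg_cost A xs \<ge> 0"
  unfolding alg_cost_def by (intro sum_nonneg cfg_cost_nonneg)

lemma alg_cost_map: "alg_cost (\<lambda>xs. A (map f xs)) xs = alg_cost A (map f xs)"
  by (simp add: alg_cost_def take_map)

text \<open>Projections of an algorithm need not serve the requests, so they fall outside
  \<open>online_alg\<close>. The cost estimates still apply to them, but they do need finiteness:
  \<open>cfg_cost\<close> is 0 by convention when infinitely many servers move.\<close>

definition finite_moves :: "(real list \<Rightarrow> nat \<Rightarrow> real) \<Rightarrow> bool" where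
  "finite_moves A \<longleftrightarrow> A [] = (\<lambda>_. 0) \<and> (\<forall>xs r. finite {i. A xs i \<noteq> A (xs @ [r]) i})"

lemma online_alg_finite_moves: "online_alg U A \<Longrightarrow> finite_moves A"
  by (simp add: online_alg_def valid_step_def finite_moves_def)

lemma finite_moves_support:
  assumes "finite_moves A"
  shows "finite {i. A xs i \<noteq> 0}"
proof (induction xs rule: rev_induct)
  case Nil
  then show ?case using assms by (simp add: finite_moves_def)
next
  case (snoc r xs)
  have "{i. A (xs @ [r]) i \<noteq> 0} \<subseteq> {i. A xs i \<noteq> A (xs @ [r]) i} \<union> {i. A xs i \<noteq> 0}" by auto
  with snoc assms show ?case unfolding finite_moves_def
    by (meson finite_UnI finite_subset)
qed

lemma finite_moves_map:
  "finite_moves A \<Longrightarrow> finite_moves (\<lambda>xs. A (map f xs))"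
  by (simp add: finite_moves_def)

lemma finite_moves_comp:
  assumes "finite_moves A" "f 0 = (0::real)"
  shows "finite_moves (\<lambda>xs i. f (A xs i))"
proof -
  have "finite {i. f (A xs i) \<noteq> f (A (xs @ [r]) i)}" for xs r
    by (rule finite_subset[of _ "{i. A xs i \<noteq> A (xs @ [r]) i}"])
      (use assms in \<open>auto simp: finite_moves_def\<close>)
  then show ?thesis using assms by (auto simp: finite_moves_def)
qed

text \<open>Triangle inequality along the run. It later prices both the return of all servers to 0
  and the jump to the configuration reached by a replay.\<close>

lemma cfg_cost_le_alg_cost:
  assumes "finite_moves A"
  shows "cfg_cost (\<lambda>_. 0) (A xs) \<le> alg_cost A xs"
proof (induction xs rule: rev_induct)
  case Nil
  then show ?case using assms by (simp add: finite_moves_def cfg_cost_def)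
next
  case (snoc r xs)
  have "cfg_cost (\<lambda>_. 0) (A (xs @ [r])) \<le>
      cfg_cost (\<lambda>_. 0) (A xs) + cfg_cost (A xs) (A (xs @ [r]))"
    using finite_moves_support[OF assms, of xs] assms
    by (intro cfg_cost_triangle) (auto simp: finite_moves_def)
  with snoc show ?case by simp
qed

text \<open>One server can follow all requests. This keeps the infimum in \<open>opt_cost\<close>
  from ranging over the empty set, where its value is unspecified.\<close>

lemma schedule_exists:
  assumes "u \<in> U"
  shows "\<exists>S. schedule U \<sigma> S"
proof
  let ?S = "\<lambda>j i. if i = u \<and> j > 0 then \<sigma> ! (j - 1) else (0::real)"
  have "finite {i. ?S j i \<noteq> ?S (Suc j) i}" for j
    by (rule finite_subset[of _ "{u}"]) auto
  then show "schedule U \<sigma> ?S"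
    using assms by (auto simp: schedule_def valid_step_def intro!: bexI[of _ u])
qed

lemma sched_cost_nonneg: "sched_cost \<sigma> S \<ge> 0"
  unfolding sched_cost_def by (intro sum_nonneg cfg_cost_nonneg)

lemma opt_cost_le: "schedule U \<sigma> S \<Longrightarrow> opt_cost U \<sigma> \<le> sched_cost \<sigma> S"
  unfolding opt_cost_def
  by (rule cInf_lower) (auto intro!: bdd_belowI[of _ 0] sched_cost_nonneg)

lemma opt_cost_greatest:
  assumes "u \<in> U" "\<And>S. schedule U \<sigma> S \<Longrightarrow> x \<le> sched_cost \<sigma> S"
  shows "x \<le> opt_cost U \<sigma>"
  unfolding opt_cost_def using schedule_exists[OF assms(1), of \<sigma>] assms(2)
  by (intro cInf_greatest) auto

lemma opt_cost_nonneg: "u \<in> U \<Longrightarrow> opt_cost U \<sigma> \<ge> 0"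
  by (erule opt_cost_greatest) (rule sched_cost_nonneg)

lemma opt_cost_snoc:
  assumes "u \<in> U"
  shows "opt_cost U xs \<le> opt_cost U (xs @ [r])"
proof (rule opt_cost_greatest[OF assms])
  fix S assume S: "schedule U (xs @ [r]) S"
  have "valid_step U (S j) (S (Suc j)) (xs ! j)" if "j < length xs" for j
    using S that unfolding schedule_def by (auto simp: nth_append dest!: spec[of _ j])
  then have "schedule U xs S" using S by (simp add: schedule_def)
  then have "opt_cost U xs \<le> sched_cost xs S" by (rule opt_cost_le)
  also have "\<dots> \<le> sched_cost (xs @ [r]) S"
    by (simp add: sched_cost_def cfg_cost_nonneg)
  finally show "opt_cost U xs \<le> sched_cost (xs @ [r]) S" .
qed

section \<open>Moving the requests away from the source\<close>

text \<open>Offline, \<open>h\<close> servers can cross the gap of length \<open>L\<close> at the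
  first request and then follow the translated schedule, while all others stay at the
  source.\<close>

lemma opt_cost_shift:
  fixes L :: real
  assumes "h \<ge> 1" "L \<ge> 0"
  shows "opt_cost UNIV (map (\<lambda>r. r + L) xs) \<le> real h * L + opt_cost {..<h} xs"
proof -
  let ?ys = "map (\<lambda>r. r + L) xs"
  have "opt_cost UNIV ?ys - real h * L \<le> sched_cost xs S" if S: "schedule {..<h} xs S" for S
  proof -
    \<comment> \<open>A schedule must start at the source, so the translation begins only at
      \<open>j > 0\<close>; the crossing is charged to step 0.\<close>
    define S' where "S' = (\<lambda>j i. if j > 0 \<and> i < h then S j i + L else 0)"
    have S0: "S 0 = (\<lambda>_. 0)" using S by (simp add: schedule_def)
    have out: "S (Suc j) i = 0" if "j < length xs" "i \<ge> h" for i j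
      using S that by (auto simp: schedule_def valid_step_def)
    have out': "S j i = 0" if "j \<le> length xs" "i \<ge> h" for i j
      using that out S0 by (cases j) auto
    have "finite {i. S' j i \<noteq> S' (Suc j) i}" for j
      by (rule finite_subset[of _ "{..<h}"]) (auto simp: S'_def not_less split: if_splits)
    moreover have "\<exists>i. S' (Suc j) i = ?ys ! j" if j: "j < length xs" for j
    proof -
      obtain i where "i < h" "S (Suc j) i = xs ! j"
        using S j by (auto simp: schedule_def valid_step_def)
      then show ?thesis using j by (auto simp: S'_def intro!: exI[of _ i])
    qed
    ultimately have "schedule UNIV ?ys S'"
      by (auto simp: schedule_def valid_step_def S'_def)
    then have "opt_cost UNIV ?ys \<le> sched_cost ?ys S'" by (rule opt_cost_le)
    also have "\<dots> \<le> (\<Sum>j<length xs. cfg_cost (S j) (S (Suc j)) + (if j = 0 then real h * L else 0))"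
      unfolding sched_cost_def length_map
    proof (rule sum_mono)
      fix j assume j: "j \<in> {..<length xs}"
      have "cfg_cost (S' j) (S' (Suc j)) = (\<Sum>i<h. \<bar>S' (Suc j) i - S' j i\<bar>)"
        by (rule cfg_cost_eq_sum_lessThan) (simp add: S'_def)
      also have "\<dots> \<le> (\<Sum>i<h. \<bar>S (Suc j) i - S j i\<bar> + (if j = 0 then L else 0))"
        using assms(2) by (intro sum_mono) (auto simp: S'_def S0)
      also have "\<dots> = cfg_cost (S j) (S (Suc j)) + (if j = 0 then real h * L else 0)"
      proof -
        have "cfg_cost (S j) (S (Suc j)) = (\<Sum>i<h. \<bar>S (Suc j) i - S j i\<bar>)"
          by (rule cfg_cost_eq_sum_lessThan) (use j out out' in simp)
        then show ?thesis by (simp add: sum.distrib)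
      qed
      finally show "cfg_cost (S' j) (S' (Suc j)) \<le>
        cfg_cost (S j) (S (Suc j)) + (if j = 0 then real h * L else 0)" .
    qed
    also have "\<dots> \<le> sched_cost xs S + real h * L"
      using assms by (simp add: sum.distrib sched_cost_def sum.delta)
    finally show ?thesis by simp
  qed
  then have "opt_cost UNIV ?ys - real h * L \<le> opt_cost {..<h} xs"
    using assms(1) by (intro opt_cost_greatest[of 0]) auto
  then show ?thesis by simp
qed

text \<open>The retraction of the line onto the half-line from \<open>L\<close> on, in coordinates
  with origin \<open>L\<close>: servers that have not arrived are seen at 0.\<close>

definition beyond :: "real \<Rightarrow> real \<Rightarrow> real" where
  "beyond L y = max 0 (y - L)"

text \<open>Each position is the sum of the monotone functions \<open>beyond L y\<close> and \<open>min y L\<close>; every server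
  that has reached \<open>L\<close> has spent at least \<open>L\<close> on the second summand.\<close>
lemma alg_cost_beyond:
  assumes A: "finite_moves A" and L: "L > 0"
  shows "finite {i. L \<le> A xs i}"
    and "alg_cost (\<lambda>xs i. beyond L (A xs i)) xs + real (card {i. L \<le> A xs i}) * L \<le> alg_cost A xs"
proof -
  let ?P = "\<lambda>xs i. beyond L (A xs i)" and ?G = "\<lambda>xs i. min (A xs i) L"
  have G: "finite_moves ?G" using finite_moves_comp[OF A, of "\<lambda>y. min y L"] L by simp
  have "alg_cost ?P xs + alg_cost ?G xs = alg_cost A xs"
  proof (induction xs rule: rev_induct)
    case (snoc r xs)
    let ?X = "{i. A xs i \<noteq> A (xs @ [r]) i}"
    have X: "finite ?X" using A by (simp add: finite_moves_def)
    have "cfg_cost (?P xs) (?P (xs @ [r])) + cfg_cost (?G xs) (?G (xs @ [r])) =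
        (\<Sum>i\<in>?X. \<bar>?P (xs @ [r]) i - ?P xs i\<bar> + \<bar>?G (xs @ [r]) i - ?G xs i\<bar>)"
      unfolding sum.distrib using X by (subst (1 2) cfg_cost_eq_sum[of ?X]) auto
    also have "\<dots> = cfg_cost (A xs) (A (xs @ [r]))"
      unfolding cfg_cost_def by (rule sum.cong) (auto simp: beyond_def)
    finally show ?case using snoc by simp
  qed simp
  moreover have "real (card {i. L \<le> A xs i}) * L \<le> cfg_cost (\<lambda>_. 0) (?G xs)"
  proof -
    let ?Y = "{i. A xs i \<noteq> 0}"
    have Y: "finite ?Y" by (rule finite_moves_support[OF A])
    have "real (card {i. L \<le> A xs i}) * L = (\<Sum>i\<in>{i. L \<le> A xs i}. L)" by simp
    also have "\<dots> = (\<Sum>i\<in>{i. L \<le> A xs i}. \<bar>?G xs i - 0\<bar>)"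
      using L by (intro sum.cong) auto
    also have "\<dots> \<le> (\<Sum>i\<in>?Y. \<bar>?G xs i - 0\<bar>)"
      using Y L by (intro sum_mono2) auto
    also have "\<dots> = cfg_cost (\<lambda>_. 0) (?G xs)"
      using Y L by (intro cfg_cost_eq_sum[symmetric]) auto
    finally show ?thesis .
  qed
  ultimately show "alg_cost ?P xs + real (card {i. L \<le> A xs i}) * L \<le> alg_cost A xs"
    using cfg_cost_le_alg_cost[OF G, of xs] by linarith
  show "finite {i. L \<le> A xs i}"
    by (rule finite_subset[OF _ finite_moves_support[OF A, of xs]]) (use L in auto)
qed

section \<open>Assigning the active servers to finitely many slots\<close>

text \<open>Indices that stay active keep their slots, and newcomers fit into the free slots because
  at most \<open>B\<close> indices are active afterwards.\<close>

lemma extend_injection: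
  fixes f :: "'a \<Rightarrow> nat"
  assumes "inj_on f S" "f ` S \<subseteq> {..<B}" "finite S'" "card S' \<le> B"
  shows "\<exists>f'. inj_on f' S' \<and> f' ` S' \<subseteq> {..<B} \<and> (\<forall>i\<in>S \<inter> S'. f' i = f i)"
proof -
  let ?K = "S \<inter> S'" and ?F = "{..<B} - f ` (S \<inter> S')"
  have inj: "inj_on f ?K" using assms(1) by (rule inj_on_subset) auto
  have "card (S' - ?K) = card S' - card ?K"
    using assms(3) by (intro card_Diff_subset) auto
  moreover have "card ?F = B - card ?K"
    using assms(2,3) inj by (subst card_Diff_subset) (auto simp: card_image)
  ultimately have "card (S' - ?K) \<le> card ?F" using assms(4) by simp
  then obtain g where g: "g ` (S' - ?K) \<subseteq> ?F" "inj_on g (S' - ?K)"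
    using card_le_inj[of "S' - ?K" ?F] assms(3) by auto
  define f' where "f' i = (if i \<in> ?K then f i else g i)" for i
  have "inj_on f' S'"
  proof (rule inj_onI)
    fix i j assume "i \<in> S'" "j \<in> S'" "f' i = f' j"
    then show "i = j" using g inj unfolding f'_def inj_on_def image_subset_iff
      by (simp split: if_splits) (metis (no_types, lifting) DiffE DiffI IntI IntE imageI)+
  qed
  moreover have "f' ` S' \<subseteq> {..<B}"
    using g assms(2) by (auto simp: f'_def image_subset_iff)
  moreover have "\<forall>i\<in>S \<inter> S'. f' i = f i" by (simp add: f'_def)
  ultimately show ?thesis by blast
qed

text \<open>The argument lists the requests in reverse order.\<close>
primrec slot :: "(real list \<Rightarrow> nat set) \<Rightarrow> nat \<Rightarrow> real list \<Rightarrow> nat \<Rightarrow> nat" where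
  "slot S B [] = id"
| "slot S B (r # ys) = (SOME f. inj_on f (S (rev ys @ [r])) \<and> f ` S (rev ys @ [r]) \<subseteq> {..<B} \<and>
     (\<forall>i\<in>S (rev ys) \<inter> S (rev ys @ [r]). f i = slot S B ys i))"

text \<open>An inactive server and an empty slot are both at 0, so taking up or giving back a slot
  costs nothing beyond the movement in \<open>P\<close> itself.\<close>

lemma relabel_servers:
  fixes P :: "real list \<Rightarrow> nat \<Rightarrow> real"
  assumes S: "S [] = {}" "\<And>xs. finite (S xs)" "\<And>xs. card (S xs) \<le> B"
    and P: "\<And>xs i. i \<notin> S xs \<Longrightarrow> P xs i = 0"
  obtains Q :: "real list \<Rightarrow> nat \<Rightarrow> real" where
    "Q [] = (\<lambda>_. 0)" "\<And>xs s. s \<ge> B \<Longrightarrow> Q xs s = 0"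
    "\<And>xs i. i \<in> S xs \<Longrightarrow> \<exists>s<B. Q xs s = P xs i"
    "\<And>xs. alg_cost Q xs \<le> alg_cost P xs"
proof -
  define f where "f xs = slot S B (rev xs)" for xs
  have step: "inj_on (f (xs @ [r])) (S (xs @ [r])) \<and> f (xs @ [r]) ` S (xs @ [r]) \<subseteq> {..<B} \<and>
     (\<forall>i\<in>S xs \<inter> S (xs @ [r]). f (xs @ [r]) i = f xs i)"
    if "inj_on (f xs) (S xs)" "f xs ` S xs \<subseteq> {..<B}" for xs r
    using someI_ex[OF extend_injection[OF that S(2) S(3), of "xs @ [r]"]]
    by (simp add: f_def)
  have inj: "inj_on (f xs) (S xs) \<and> f xs ` S xs \<subseteq> {..<B}" for xs
  proof (induction xs rule: rev_induct)
    case Nil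
    then show ?case by (simp add: S)
  next
    case (snoc r xs)
    then show ?case using step by blast
  qed
  have keep: "f (xs @ [r]) i = f xs i" if "i \<in> S xs" "i \<in> S (xs @ [r])" for xs r i
    using step inj that by blast
  define Q where "Q xs s = (\<Sum>i\<in>S xs. if f xs i = s then P xs i else 0)" for xs s
  have Q0: "Q [] = (\<lambda>_. 0)" by (simp add: Q_def S fun_eq_iff)
  have QB: "Q xs s = 0" if "s \<ge> B" for xs s
    unfolding Q_def by (rule sum.neutral) (use that inj[of xs] in auto)
  have QP: "\<exists>s<B. Q xs s = P xs i" if i: "i \<in> S xs" for xs i
  proof (intro exI conjI)
    show "f xs i < B" using inj i by auto
    have "Q xs (f xs i) = (\<Sum>j\<in>S xs. if j = i then P xs j else 0)"
      unfolding Q_def using inj[of xs] i by (intro sum.cong) (auto simp: inj_on_def)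
    then show "Q xs (f xs i) = P xs i" using i S(2) by (simp add: sum.delta)
  qed
  have cost: "cfg_cost (Q xs) (Q (xs @ [r])) \<le> cfg_cost (P xs) (P (xs @ [r]))" for xs r
  proof -
    let ?xs' = "xs @ [r]"
    let ?U = "S xs \<union> S ?xs'"
    \<comment> \<open>Each server involved in the step gets one slot for the whole step. A departing
      and an arriving server may share a slot, hence only an inequality for the costs.\<close>
    define g where "g i = (if i \<in> S xs then f xs i else f ?xs' i)" for i
    let ?\<Delta> = "\<lambda>i. P ?xs' i - P xs i"
    have U: "finite ?U" using S(2) by simp
    have eq: "Q ?xs' s - Q xs s = (\<Sum>i\<in>?U. if g i = s then ?\<Delta> i else 0)" for s
    proof -
      have 1: "Q xs s = (\<Sum>i\<in>?U. if g i = s then P xs i else 0)"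
        unfolding Q_def by (rule sum.mono_neutral_cong_left) (use U P in \<open>auto simp: g_def\<close>)
      have 2: "Q ?xs' s = (\<Sum>i\<in>?U. if g i = s then P ?xs' i else 0)"
        unfolding Q_def
        by (rule sum.mono_neutral_cong_left) (use U P keep in \<open>auto simp: g_def\<close>)
      show ?thesis unfolding 1 2 sum_subtractf[symmetric] by (rule sum.cong) auto
    qed
    have "cfg_cost (Q xs) (Q ?xs') = (\<Sum>s<B. \<bar>Q ?xs' s - Q xs s\<bar>)"
      by (rule cfg_cost_eq_sum_lessThan) (simp add: QB)
    also have "\<dots> \<le> (\<Sum>s<B. \<Sum>i\<in>?U. \<bar>if g i = s then ?\<Delta> i else 0\<bar>)"
      unfolding eq by (intro sum_mono sum_abs)
    also have "\<dots> = (\<Sum>i\<in>?U. \<Sum>s<B. if g i = s then \<bar>?\<Delta> i\<bar> else 0)"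
      by (subst sum.swap) (intro sum.cong refl, auto)
    also have "\<dots> \<le> (\<Sum>i\<in>?U. \<bar>?\<Delta> i\<bar>)"
      by (intro sum_mono) (simp add: sum.delta)
    also have "\<dots> = cfg_cost (P xs) (P ?xs')"
      by (rule cfg_cost_eq_sum[symmetric, OF U]) (use P in force)
    finally show ?thesis .
  qed
  have "alg_cost Q xs \<le> alg_cost P xs" for xs
    by (induction xs rule: rev_induct) (use cost in \<open>auto intro: add_mono\<close>)
  with Q0 QB QP show ?thesis by (rule that)
qed

section \<open>The half-line\<close>

text \<open>The distance between the source and the half-line in the current simulation; the argument
  lists the requests in reverse order.\<close>
primrec level ::
  "(real list \<Rightarrow> nat \<Rightarrow> real) \<Rightarrow> nat \<Rightarrow> nat \<Rightarrow> real \<Rightarrow> real \<Rightarrow> real list \<Rightarrow> real" where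
  "level A B h \<epsilon> L0 [] = L0"
| "level A B h \<epsilon> L0 (r # ys) =
     (let L = level A B h \<epsilon> L0 ys; xs = rev ys @ [r] in
      if card {i. L \<le> A (map (\<lambda>r. r + L) xs) i} \<le> B then L
      else \<epsilon> * opt_cost {..<h} xs / real h)"

lemma half_line:
  fixes \<rho> \<epsilon> c :: real
  assumes A: "online_alg UNIV A" and comp: "\<And>\<sigma>. alg_cost A \<sigma> \<le> \<rho> * opt_cost UNIV \<sigma> + c"
    and pos: "h \<ge> 1" "\<epsilon> > 0" "\<rho> > 0"
    and B: "(1 + 1 / \<epsilon>) * \<rho> * real h \<le> real B"
  obtains Q c' where
    "Q [] = (\<lambda>_. 0)" "\<And>xs s. s \<ge> B \<Longrightarrow> Q xs s = 0"
    "\<And>xs r. r \<ge> 0 \<Longrightarrow> \<exists>s<B. Q (xs @ [r]) s = r"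
    "\<And>xs. alg_cost Q xs \<le> (3 + \<epsilon>) * \<rho> * opt_cost {..<h} xs + c'"
proof -
  define sim where "sim L xs = A (map (\<lambda>r. r + L) xs)" for L xs
  \<comment> \<open>A server exactly at \<open>L\<close> counts as active, so that a request at 0 is
    also served from a slot.\<close>
  define act where "act L xs = {i. L \<le> sim L xs i}" for L xs
  define pr where "pr L xs i = beyond L (sim L xs i)" for L xs i
  define opt where "opt = opt_cost {..<h}"
  \<comment> \<open>\<open>L0 > c\<close> lets the extra active server at a switch absorb \<open>c\<close>, however many switches occur.\<close>
  define L0 where "L0 = max c 0 + 1"
  define lev where "lev xs = level A B h \<epsilon> L0 (rev xs)" for xs
  \<comment> \<open>The optimum at which the switching rule would choose the level \<open>L\<close>;
    after a switch it is the optimum at the time of that switch.\<close>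
  define T where "T L = real h * L / \<epsilon>" for L

  have lev_Nil: "lev [] = L0" by (simp add: lev_def)
  have lev_snoc: "lev (xs @ [r]) = (if card (act (lev xs) (xs @ [r])) \<le> B then lev xs
      else \<epsilon> * opt (xs @ [r]) / real h)" for xs r
    by (simp add: lev_def act_def sim_def opt_def Let_def)

  have h0: "0 \<in> {..<h}" using pos by simp
  have opt_nonneg: "opt xs \<ge> 0" for xs
    unfolding opt_def by (rule opt_cost_nonneg[OF h0])
  have L0: "L0 > c" "L0 > 0" by (auto simp: L0_def)
  have fin_sim: "finite_moves (sim L)" for L
    unfolding sim_def[abs_def] by (intro finite_moves_map online_alg_finite_moves[OF A])
  have fin_pr: "finite_moves (pr L)" if "L > 0" for L
    using finite_moves_comp[OF fin_sim, of "beyond L" L] that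
    by (simp add: pr_def[abs_def] beyond_def)

  have inside: "alg_cost (pr L) xs + real (card (act L xs)) * L \<le> \<rho> * (real h * L + opt xs) + c"
    if "L > 0" for L xs
  proof -
    have "alg_cost (pr L) xs + real (card (act L xs)) * L \<le> alg_cost (sim L) xs"
      using alg_cost_beyond(2)[OF fin_sim that, of L xs] by (simp add: pr_def[abs_def] act_def)
    also have "\<dots> \<le> \<rho> * opt_cost UNIV (map (\<lambda>r. r + L) xs) + c"
      using comp by (simp add: sim_def[abs_def] alg_cost_map)
    also have "\<dots> \<le> \<rho> * (real h * L + opt xs) + c"
      using opt_cost_shift[of h L xs] pos that by (simp add: opt_def)
    finally show ?thesis .
  qed

  \<comment> \<open>This determines \<open>B\<close>: the crossings of \<open>B\<close> servers
    already cost \<open>\<rho> * (real h * L + T L)\<close>, which cancels the charge for the gap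
    and leaves \<open>- \<rho> * T L\<close>. One more server contributes the \<open>L\<close> that
    pays for \<open>c\<close>.\<close>
  have overflow: "alg_cost (pr L) xs + (L - c) \<le> \<rho> * (opt xs - T L)"
    if "L > 0" "card (act L xs) > B" for L xs
  proof -
    have "real (card (act L xs)) \<ge> real B + 1" using that by linarith
    then have "real (card (act L xs)) * L \<ge> ((1 + 1 / \<epsilon>) * \<rho> * real h + 1) * L"
      using that B by (intro mult_right_mono) auto
    moreover have "((1 + 1 / \<epsilon>) * \<rho> * real h + 1) * L = \<rho> * (real h * L) + \<rho> * T L + L"
      using pos by (simp add: T_def field_simps)
    ultimately show ?thesis using inside[OF that(1), of xs] by (simp add: algebra_simps)
  qed

  define P where "P xs = pr (lev xs) xs" for xs

  \<comment> \<open>The \<open>max\<close> covers the time before the first switch, when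
    \<open>T L0\<close> may exceed the optimum. The factor 2 pays each abandoned simulation once for
    what it spent and once for the return to 0; these bounds telescope in \<open>T\<close>.\<close>
  have inv: "lev xs \<ge> L0 \<and> T (lev xs) \<le> max (T L0) (opt xs) \<and> card (act (lev xs) xs) \<le> B \<and>
      alg_cost P xs \<le> 2 * \<rho> * (T (lev xs) - T L0) + alg_cost (pr (lev xs)) xs" for xs
  proof (induction xs rule: rev_induct)
    case Nil
    have "sim L0 [] = (\<lambda>_. 0)" using fin_sim[of L0] by (simp add: finite_moves_def)
    then show ?case using L0 by (auto simp: lev_Nil act_def)
  next
    case (snoc r xs)
    let ?xs' = "xs @ [r]" and ?L = "lev xs"
    have L: "?L > 0" "?L > c" using snoc L0 by auto
    have mono: "opt xs \<le> opt ?xs'" unfolding opt_def by (rule opt_cost_snoc[OF h0])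
    show ?case
    proof (cases "card (act ?L ?xs') \<le> B")
      case True
      then have "lev ?xs' = ?L" by (simp add: lev_snoc)
      then show ?thesis using snoc mono True by (auto simp: P_def)
    next
      case False
      let ?L' = "\<epsilon> * opt ?xs' / real h"
      have lev': "lev ?xs' = ?L'" using False by (simp add: lev_snoc)
      have T': "T ?L' = opt ?xs'" using pos by (simp add: T_def)
      have over: "alg_cost (pr ?L) ?xs' + (?L - c) \<le> \<rho> * (opt ?xs' - T ?L)"
        using overflow[OF L(1), of ?xs'] False by (simp only: not_le)
      then have "0 \<le> \<rho> * (opt ?xs' - T ?L)" using alg_cost_nonneg[of "pr ?L" ?xs'] L by linarith
      then have "T ?L \<le> T ?L'" using pos T' by (simp add: zero_le_mult_iff)
      then have L': "?L' \<ge> ?L" using pos by (simp add: T_def field_simps)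
      \<comment> \<open>The new simulation cannot overflow at once: at its own threshold the
        right-hand side of \<open>overflow\<close> vanishes, while the left-hand side is
        positive.\<close>
      have card': "card (act ?L' ?xs') \<le> B"
      proof (rule ccontr)
        assume "\<not> ?thesis"
        then have "alg_cost (pr ?L') ?xs' + (?L' - c) \<le> \<rho> * (opt ?xs' - T ?L')"
          using L L' by (intro overflow) linarith+
        then show False using T' L L' alg_cost_nonneg[of "pr ?L'" ?xs'] by (simp del: alg_cost_snoc)
      qed
      have pos': "?L' > 0" using L L' by linarith
      \<comment> \<open>The switch is compared with a detour through 0. The return costs at most
        what the old simulation spent, and the way out at most the cost of the replay, which becomes
        the last term of the invariant.\<close>
      have "cfg_cost (P xs) (P ?xs') \<le>
          cfg_cost (P xs) (\<lambda>_. 0) + cfg_cost (\<lambda>_. 0) (P ?xs')"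
        using finite_moves_support[OF fin_pr, of ?L xs]
          finite_moves_support[OF fin_pr, of ?L' ?xs'] L pos'
        by (intro cfg_cost_triangle) (auto simp: P_def lev')
      also have "\<dots> \<le> alg_cost (pr ?L) xs + alg_cost (pr ?L') ?xs'"
        using cfg_cost_le_alg_cost[OF fin_pr[OF L(1)], of xs]
          cfg_cost_le_alg_cost[OF fin_pr[OF pos'], of ?xs']
        by (simp only: P_def lev' cfg_cost_commute[of _ "\<lambda>_. 0"])
      finally have "alg_cost P ?xs' \<le>
          2 * \<rho> * (T ?L - T L0) + 2 * alg_cost (pr ?L) xs + alg_cost (pr ?L') ?xs'"
        using snoc by simp
      \<comment> \<open>The overflow bound includes the request that ends the old simulation,
        whereas the actual play stopped one request earlier.\<close>
      moreover have "alg_cost (pr ?L) xs \<le> alg_cost (pr ?L) ?xs'"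
        by (simp add: cfg_cost_nonneg)
      moreover have "alg_cost (pr ?L) ?xs' \<le> \<rho> * T ?L' - \<rho> * T ?L"
        using over L T' by (simp del: alg_cost_snoc add: right_diff_distrib)
      ultimately have "alg_cost P ?xs' \<le> 2 * \<rho> * (T ?L' - T L0) + alg_cost (pr ?L') ?xs'"
        by (simp only: right_diff_distrib)
      then show ?thesis using card' L' T' snoc unfolding lev' by auto
    qed
  qed

  \<comment> \<open>The constant \<open>\<rho> * \<epsilon> * T L0\<close> is
    \<open>\<rho> * real h * L0\<close>, the charge for the initial gap.\<close>
  have cost: "alg_cost P xs \<le> (3 + \<epsilon>) * \<rho> * opt xs + (\<rho> * \<epsilon> * T L0 + c)" for xs
  proof -
    let ?L = "lev xs"
    have L: "?L > 0" using inv L0 by (meson less_le_trans)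
    have T0: "T L0 \<ge> 0" using pos L0 by (simp add: T_def)
    have TL: "T ?L \<le> T L0 + opt xs" using inv[of xs] T0 opt_nonneg[of xs] by linarith
    have hL: "real h * ?L = \<epsilon> * T ?L" using pos by (simp add: T_def)
    have "alg_cost (pr ?L) xs + 0 \<le> alg_cost (pr ?L) xs + real (card (act ?L xs)) * ?L"
      using L by (intro add_left_mono) simp
    then have "alg_cost (pr ?L) xs \<le> \<rho> * (\<epsilon> * T ?L + opt xs) + c"
      using inside[OF L, of xs] by (simp only: hL)
    also have "\<dots> \<le> \<rho> * (\<epsilon> * (T L0 + opt xs) + opt xs) + c"
      using TL pos by simp
    finally have "alg_cost (pr ?L) xs \<le> \<rho> * (\<epsilon> * (T L0 + opt xs) + opt xs) + c" .
    moreover have "2 * \<rho> * (T ?L - T L0) \<le> 2 * \<rho> * opt xs"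
      using TL pos by (intro mult_left_mono) auto
    ultimately show ?thesis using inv[of xs] by (simp add: algebra_simps)
  qed

  have levpos: "lev xs > 0" for xs using inv L0 by (meson less_le_trans)
  show ?thesis
  proof (rule relabel_servers[of "\<lambda>xs. act (lev xs) xs" B P])
    show "act (lev []) [] = {}"
      using fin_sim[of L0] L0 by (auto simp: lev_Nil act_def finite_moves_def)
    show "finite (act (lev xs) xs)" for xs
      unfolding act_def by (rule alg_cost_beyond(1)[OF fin_sim levpos])
    show "card (act (lev xs) xs) \<le> B" for xs using inv by blast
    show "P xs i = 0" if "i \<notin> act (lev xs) xs" for xs i
      using that by (simp add: P_def pr_def act_def beyond_def)
  next
    fix Q :: "real list \<Rightarrow> nat \<Rightarrow> real"
    assume Q: "Q [] = (\<lambda>_. 0)" "\<And>xs s. s \<ge> B \<Longrightarrow> Q xs s = 0"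
      "\<And>xs i. i \<in> act (lev xs) xs \<Longrightarrow> \<exists>s<B. Q xs s = P xs i"
      "\<And>xs. alg_cost Q xs \<le> alg_cost P xs"
    have "\<exists>s<B. Q (xs @ [r]) s = r" if r: "r \<ge> 0" for xs r
    proof -
      \<comment> \<open>The level after the request is the relevant one: on a switch the replay
        already includes \<open>r\<close>, so the new simulation serves it.\<close>
      let ?L = "lev (xs @ [r])"
      obtain i where i: "sim ?L (xs @ [r]) i = r + ?L"
        using A unfolding online_alg_def valid_step_def sim_def by fastforce
      then have "i \<in> act ?L (xs @ [r])" "P (xs @ [r]) i = r"
        using r by (auto simp: act_def P_def pr_def beyond_def)
      then show ?thesis using Q(3) by metis
    qed
    moreover have "alg_cost Q xs \<le> (3 + \<epsilon>) * \<rho> * opt_cost {..<h} xs + (\<rho> * \<epsilon> * T L0 + c)" for xs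
      using Q(4)[of xs] cost[of xs] by (simp add: opt_def)
    ultimately show ?thesis using Q(1,2) that by blast
  qed
qed

section \<open>The real line\<close>

text \<open>The positive and negative parts of a schedule serve the two projected sequences, and
  every movement splits exactly into the movements of its two parts.\<close>

lemma opt_cost_split:
  assumes "h \<ge> 1"
  shows "opt_cost {..<h} (map (max 0) \<sigma>) + opt_cost {..<h} (map (\<lambda>r. max 0 (- r)) \<sigma>)
    \<le> opt_cost {..<h} \<sigma>"
proof (rule opt_cost_greatest[of 0])
  show "0 \<in> {..<h}" using assms by simp
  fix S assume S: "schedule {..<h} \<sigma> S"
  have proj: "schedule {..<h} (map f \<sigma>) (\<lambda>j i. f (S j i))" if "f 0 = 0" for f
  proof -
    have "finite {i. f (S j i) \<noteq> f (S (Suc j) i)}" if "j < length \<sigma>" for j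
      by (rule finite_subset[of _ "{i. S j i \<noteq> S (Suc j) i}"])
        (use S that in \<open>auto simp: schedule_def valid_step_def\<close>)
    moreover have "\<exists>i\<in>{..<h}. f (S (Suc j) i) = f (\<sigma> ! j)" if "j < length \<sigma>" for j
      using S that unfolding schedule_def valid_step_def by metis
    ultimately show ?thesis using S that by (simp add: schedule_def valid_step_def)
  qed
  let ?p = "max (0::real)" and ?n = "\<lambda>r::real. max 0 (- r)"
  have "cfg_cost (\<lambda>i. ?p (S j i)) (\<lambda>i. ?p (S (Suc j) i)) +
      cfg_cost (\<lambda>i. ?n (S j i)) (\<lambda>i. ?n (S (Suc j) i)) = cfg_cost (S j) (S (Suc j))"
    if "j < length \<sigma>" for j
  proof -
    let ?X = "{i. S j i \<noteq> S (Suc j) i}"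
    have X: "finite ?X" using S that by (auto simp: schedule_def valid_step_def)
    have "cfg_cost (\<lambda>i. ?p (S j i)) (\<lambda>i. ?p (S (Suc j) i)) +
        cfg_cost (\<lambda>i. ?n (S j i)) (\<lambda>i. ?n (S (Suc j) i)) =
        (\<Sum>i\<in>?X. \<bar>?p (S (Suc j) i) - ?p (S j i)\<bar> + \<bar>?n (S (Suc j) i) - ?n (S j i)\<bar>)"
      unfolding sum.distrib using X by (subst (1 2) cfg_cost_eq_sum[of ?X]) auto
    also have "\<dots> = cfg_cost (S j) (S (Suc j))"
      unfolding cfg_cost_def by (rule sum.cong) auto
    finally show ?thesis .
  qed
  then have "sched_cost (map ?p \<sigma>) (\<lambda>j i. ?p (S j i)) + sched_cost (map ?n \<sigma>) (\<lambda>j i. ?n (S j i))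
      = sched_cost \<sigma> S"
    by (simp add: sched_cost_def flip: sum.distrib)
  with opt_cost_le[OF proj[of ?p]] opt_cost_le[OF proj[of ?n]]
  show "opt_cost {..<h} (map ?p \<sigma>) + opt_cost {..<h} (map ?n \<sigma>) \<le> sched_cost \<sigma> S"
    by simp
qed

text \<open>A single request farther away than \<open>\<bar>c\<bar>\<close> costs more than
  \<open>c\<close>, which a ratio at most 0 would forbid.\<close>

lemma competitive_ratio_pos:
  assumes A: "online_alg UNIV A" and comp: "\<And>\<sigma>. alg_cost A \<sigma> \<le> \<rho> * opt_cost UNIV \<sigma> + c"
  shows "\<rho> > 0"
proof (rule ccontr)
  assume "\<not> \<rho> > 0"
  define x where "x = \<bar>c\<bar> + 1"
  have A0: "A [] = (\<lambda>_. 0)" and step: "valid_step UNIV (A []) (A ([] @ [x])) x"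
    using A unfolding online_alg_def by blast+
  then obtain i where i: "A [x] i = x" by (auto simp: valid_step_def)
  have "x = \<bar>A [x] i - A [] i\<bar>" using i A0 by (simp add: x_def)
  also have "\<dots> \<le> cfg_cost (A []) (A [x])"
    unfolding cfg_cost_def using step i A0
    by (intro member_le_sum) (auto simp: valid_step_def x_def)
  also have "\<dots> = alg_cost A [x]" using alg_cost_snoc[of A "[]" x] by simp
  also have "\<dots> \<le> \<rho> * opt_cost UNIV [x] + c" by (rule comp)
  also have "\<dots> \<le> c"
    using \<open>\<not> \<rho> > 0\<close> opt_cost_nonneg[of 0 UNIV "[x]"] by (simp add: mult_nonpos_nonneg)
  finally show False by (simp add: x_def)
qed

lemma sum_lessThan_add:
  fixes f :: "nat \<Rightarrow> real"
  shows "(\<Sum>s<m + n. f s) = (\<Sum>s<m. f s) + (\<Sum>s<n. f (m + s))"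
  by (induction n) (auto simp: add.assoc)

theorem theorem4:
  fixes \<rho> \<epsilon> :: real and h k :: nat
  assumes "competitive UNIV UNIV \<rho>"
    and "h \<ge> 1" and "\<epsilon> > 0"
    and "int k \<ge> 2 * \<lceil>(1 + 1 / \<epsilon>) * \<rho> * real h\<rceil>"
  shows "competitive {..<k} {..<h} ((3 + \<epsilon>) * \<rho>)"
proof -
  obtain A c where A: "online_alg UNIV A" "\<And>\<sigma>. alg_cost A \<sigma> \<le> \<rho> * opt_cost UNIV \<sigma> + c"
    using assms(1) unfolding competitive_def by blast
  have \<rho>: "\<rho> > 0" using A by (rule competitive_ratio_pos)
  define B where "B = nat \<lceil>(1 + 1 / \<epsilon>) * \<rho> * real h\<rceil>"
  have B: "(1 + 1 / \<epsilon>) * \<rho> * real h \<le> real B" unfolding B_def by (rule real_nat_ceiling_ge)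
  have k: "2 * B \<le> k" unfolding B_def using assms(4) by linarith
  obtain Q c' where Q: "Q [] = (\<lambda>_. 0)" "\<And>xs s. s \<ge> B \<Longrightarrow> Q xs s = 0"
    "\<And>xs r. r \<ge> 0 \<Longrightarrow> \<exists>s<B. Q (xs @ [r]) s = r"
    "\<And>xs. alg_cost Q xs \<le> (3 + \<epsilon>) * \<rho> * opt_cost {..<h} xs + c'"
    using half_line[OF A assms(2,3) \<rho> B] by metis
  let ?p = "max (0::real)" and ?n = "\<lambda>r::real. max 0 (- r)"
  \<comment> \<open>The second block of \<open>B\<close> servers mirrors the negative side. Each
    block sees the other side's requests as requests at 0, and servers from \<open>2 * B\<close> on
    stay idle.\<close>
  define R where "R xs s = (if s < B then Q (map ?p xs) s else - Q (map ?n xs) (s - B))" for xs s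
  have R_out: "R xs s = 0" if "s \<ge> 2 * B" for xs s
    using that by (simp add: R_def Q(2))
  have R_fin: "{s. R xs s \<noteq> R ys s} \<subseteq> {..<2 * B}" for xs ys
    using R_out by (auto simp flip: not_le)
  have R_serves: "\<exists>s<k. R (xs @ [r]) s = r" for xs r
  proof (cases "r \<ge> 0")
    case True
    then obtain s where "s < B" "Q (map ?p xs @ [r]) s = r" using Q(3) by blast
    then show ?thesis using True k by (intro exI[of _ s]) (simp add: R_def max_def)
  next
    case False
    then obtain s where "s < B" "Q (map ?n xs @ [- r]) s = - r"
      using Q(3)[of "- r"] by force
    then show ?thesis using False k by (intro exI[of _ "B + s"]) (simp add: R_def max_def)
  qed
  have "online_alg {..<k} R"
    unfolding online_alg_def valid_step_def
  proof (intro conjI allI impI)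
    show "R [] = (\<lambda>_. 0)" by (simp add: R_def Q(1) fun_eq_iff)
    show "R (xs @ [r]) i = 0" if "i \<notin> {..<k}" for xs r i
      using that k by (intro R_out) simp
    show "finite {i. R xs i \<noteq> R (xs @ [r]) i}" for xs r
      by (rule finite_subset[OF R_fin]) simp
    show "\<exists>i\<in>{..<k}. R (xs @ [r]) i = r" for xs r using R_serves by blast
  qed
  moreover have "alg_cost R \<sigma> \<le> (3 + \<epsilon>) * \<rho> * opt_cost {..<h} \<sigma> + 2 * c'" for \<sigma>
  proof -
    have Q_cfg: "cfg_cost (Q xs) (Q ys) = (\<Sum>s<B. \<bar>Q ys s - Q xs s\<bar>)" for xs ys
      by (rule cfg_cost_eq_sum_lessThan) (simp add: Q(2))
    have "cfg_cost (R xs) (R ys) =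
        cfg_cost (Q (map ?p xs)) (Q (map ?p ys)) + cfg_cost (Q (map ?n xs)) (Q (map ?n ys))" for xs ys
    proof -
      have "cfg_cost (R xs) (R ys) = (\<Sum>s<B + B. \<bar>R ys s - R xs s\<bar>)"
        by (rule cfg_cost_eq_sum_lessThan) (simp add: R_out)
      also have "\<dots> = (\<Sum>s<B. \<bar>R ys s - R xs s\<bar>) + (\<Sum>s<B. \<bar>R ys (B + s) - R xs (B + s)\<bar>)"
        by (simp add: sum_lessThan_add)
      finally show ?thesis by (simp add: Q_cfg R_def abs_minus_commute)
    qed
    then have "alg_cost R \<sigma> = alg_cost Q (map ?p \<sigma>) + alg_cost Q (map ?n \<sigma>)"
      by (simp add: alg_cost_def take_map sum.distrib)
    also have "\<dots> \<le> (3 + \<epsilon>) * \<rho> * (opt_cost {..<h} (map ?p \<sigma>) + opt_cost {..<h} (map ?n \<sigma>)) + 2 * c'"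
      using Q(4)[of "map ?p \<sigma>"] Q(4)[of "map ?n \<sigma>"] by (simp add: distrib_left)
    also have "\<dots> \<le> (3 + \<epsilon>) * \<rho> * opt_cost {..<h} \<sigma> + 2 * c'"
      using opt_cost_split[OF assms(2), of \<sigma>] assms(3) \<rho>
      by (intro add_right_mono mult_left_mono) auto
    finally show ?thesis .
  qed
  ultimately show ?thesis unfolding competitive_def by blast
qed

end
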